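(* Let $X_1,\dots,X_5\in\widehat{\mathbb{C}}=\partial\mathbb{H}^3$ be five distinct points, and suppose a horosphere is chosen at each of them (arbitrarily). Let $\lambda_{ij}=\lambda_{X_iX_j}$ denote the $\lambda$-lengths. Then $$\sum_{i<j}\lambda_{ij}^4\,\lambda_{kl}^2\lambda_{lm}^2\lambda_{mk}^2=\sum_{\text{cycles }(ijklm)}\lambda_{ij}^2\lambda_{jk}^2\lambda_{kl}^2\lambda_{lm}^2\lambda_{mi}^2,$$ where on the left the sum is over the $10$ pairs $i<j$ and $\{k,l,m\}$ is the complement of $\{i,j\}$ in $\{1,\dots,5\}$, and on the right the sum is over the $12$ cyclic arrangements $(ijklm)$ of $\{1,\dots,5\}$ (i.e. Hamiltonian cycles of the complete graph on $\{1,\dots,5\}$, each unoriented cycle counted once); all indices $i,j,k,l,m$ are distinct.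
   Context: Use the upper half-space model of hyperbolic space $\mathbb{H}^3$, whose boundary is $\widehat{\mathbb{C}}=\mathbb{C}\cup\{\infty\}$. $\lambda$-length (Penner): for distinct $A,B\in\partial\mathbb{H}^3$ with horospheres $h_A,h_B$ centred at $A,B$, $\lambda_{AB}=e^{d/2}$, where $d$ is the signed distance between $h_A$ and $h_B$ along the geodesic $AB$ ($d=0$ if the horoballs are tangent; if they overlap, $d$ is minus the distance between the points where $AB$ meets $h_A$ and $h_B$). *)

theory Defs
  imports "HOL-Analysis.Analysis"
begin

section \<open>The upper half-space model\<close>

datatype riemann_sphere = Fin complex | Infty

definition hyp3 :: "(complex \<times> real) set" where
  "hyp3 = {p. snd p > 0}"

text \<open>On \<^typ>\<open>complex \<times> real\<close> the library's \<^const>\<open>dist\<close>, \<^const>\<open>sphere\<close> and \<^const>\<open>ball\<close> are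
  Euclidean; the hyperbolic metric satisfies
  $\cosh d(p,q) = 1 + |p-q|^2 / (2\,t_p\,t_q)$, with $t$ the height.\<close>

definition hyp_dist :: "complex \<times> real \<Rightarrow> complex \<times> real \<Rightarrow> real" where
  "hyp_dist p q = arcosh (1 + (dist p q)\<^sup>2 / (2 * snd p * snd q))"

text \<open>The geodesic with distinct endpoints \<open>A\<close>, \<open>B\<close>: a vertical half-line, or the
  half-circle with diameter \<open>AB\<close> in the vertical plane through \<open>A\<close> and \<open>B\<close>.\<close>

fun geodesic :: "riemann_sphere \<Rightarrow> riemann_sphere \<Rightarrow> (complex \<times> real) set" where
  "geodesic (Fin a) (Fin b) =
     {p \<in> hyp3. fst p \<in> affine hull {a, b}} \<inter> sphere (midpoint a b, 0) (dist a b / 2)"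
| "geodesic (Fin a) Infty = {p \<in> hyp3. fst p = a}"
| "geodesic Infty (Fin b) = {p \<in> hyp3. fst p = b}"
| "geodesic Infty Infty = {}"

section \<open>Horospheres and horoballs\<close>

text \<open>For \<open>r > 0\<close>: the horosphere of Euclidean radius \<open>r\<close> tangent to the boundary plane at a
  finite point, or the horizontal plane of height \<open>r\<close>; and the open horoball it bounds.\<close>

fun horosphere :: "riemann_sphere \<Rightarrow> real \<Rightarrow> (complex \<times> real) set" where
  "horosphere (Fin a) r = sphere (a, r) r \<inter> hyp3"
| "horosphere Infty r = {p. snd p = r}"

fun horoball :: "riemann_sphere \<Rightarrow> real \<Rightarrow> (complex \<times> real) set" where
  "horoball (Fin a) r = ball (a, r) r"
| "horoball Infty r = {p. snd p > r}"

definition horospheres_at :: "riemann_sphere \<Rightarrow> (complex \<times> real) set set" where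
  "horospheres_at A = {horosphere A r | r. r > 0}"

definition horoball_bounded_by :: "riemann_sphere \<Rightarrow> (complex \<times> real) set \<Rightarrow> (complex \<times> real) set" where
  "horoball_bounded_by A h = (THE U. \<exists>r>0. h = horosphere A r \<and> U = horoball A r)"

lemma horosphere_inject:
  assumes "horosphere A r = horosphere A s" "r > 0" "s > 0"
  shows "r = s"
proof (cases A)
  case (Fin a)
  have "(a, 2 * r) \<in> horosphere A r"
    using assms(2) by (simp add: Fin hyp3_def dist_Pair_Pair dist_real_def)
  then have "(a, 2 * r) \<in> horosphere A s" using assms(1) by simp
  then have "\<bar>s - 2 * r\<bar> = s" by (simp add: Fin dist_Pair_Pair dist_real_def)
  then show ?thesis using assms(2) by (auto simp: abs_if split: if_splits)
next
  case Infty
  have "(0, r) \<in> horosphere A r" by (simp add: Infty)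
  then have "(0, r) \<in> horosphere A s" using assms(1) by simp
  then show ?thesis by (simp add: Infty)
qed

lemma horoball_bounded_by_horosphere:
  assumes "r > 0" shows "horoball_bounded_by A (horosphere A r) = horoball A r"
  unfolding horoball_bounded_by_def
  by (rule the_equality) (use assms horosphere_inject in blast)+

section \<open>Penner's lambda-lengths\<close>

text \<open>Here \<open>h\<close>, \<open>k\<close> are horospheres at distinct points \<open>A\<close>, \<open>B\<close>. The geodesic meets each
  of them in one point. Horoballs at distinct centres are never nested, so they overlap iff
  the open horoballs intersect; tangent ones give \<open>p = q\<close>, hence distance \<open>0\<close>.\<close>

definition signed_dist ::
    "riemann_sphere \<Rightarrow> (complex \<times> real) set \<Rightarrow> riemann_sphere \<Rightarrow> (complex \<times> real) set \<Rightarrow> real" where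
  "signed_dist A h B k =
     (let p = (THE p. p \<in> geodesic A B \<inter> h);
          q = (THE q. q \<in> geodesic A B \<inter> k)
      in if horoball_bounded_by A h \<inter> horoball_bounded_by B k = {}
         then hyp_dist p q else - hyp_dist p q)"

definition lambda_length ::
    "riemann_sphere \<Rightarrow> (complex \<times> real) set \<Rightarrow> riemann_sphere \<Rightarrow> (complex \<times> real) set \<Rightarrow> real" where
  "lambda_length A h B k = exp (signed_dist A h B k / 2)"

section \<open>Index sets of the two sums\<close>

text \<open>Splittings of \<open>{1..5}\<close> into a pair \<open>i < j\<close> and its complement, listed increasingly.\<close>

definition pair_splittings :: "(nat \<times> nat \<times> nat \<times> nat \<times> nat) set" where
  "pair_splittings = {(i, j, k, l, m). {i, j, k, l, m} = {1..5} \<and> i < j \<and> k < l \<and> l < m}"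

text \<open>Hamiltonian cycles of the complete graph on \<open>{1..5}\<close>, as edge sets, and one vertex
  sequence for each of them: rotate so that \<open>1\<close> comes first, then orient so that its
  successor is smaller than its predecessor.\<close>

definition cycle_edges :: "nat \<times> nat \<times> nat \<times> nat \<times> nat \<Rightarrow> nat set set" where
  "cycle_edges = (\<lambda>(i, j, k, l, m). {{i, j}, {j, k}, {k, l}, {l, m}, {m, i}})"

definition hamiltonian_cycles :: "nat set set set" where
  "hamiltonian_cycles = cycle_edges ` {(i, j, k, l, m). {i, j, k, l, m} = {1..5}}"

definition cyclic_arrangements :: "(nat \<times> nat \<times> nat \<times> nat \<times> nat) set" where
  "cyclic_arrangements = {(i, j, k, l, m). {i, j, k, l, m} = {1..5} \<and> i = 1 \<and> j < m}"

lemma vertices_distinct: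
  assumes "{i, j, k, l, m} = {1..5::nat}" shows "distinct [i, j, k, l, m]"
proof -
  have "card (set [i, j, k, l, m]) = length [i, j, k, l, m]"
    using assms by simp
  then show ?thesis by (rule card_distinct)
qed

lemma mem_vertices_iff: "x \<in> {1..5::nat} \<longleftrightarrow> x = 1 \<or> x = 2 \<or> x = 3 \<or> x = 4 \<or> x = 5" by auto

lemma vertices_iff: "{i, j, k, l, m} = {1..5::nat} \<longleftrightarrow>
   distinct [i,j,k,l,m] \<and> i \<in> {1..5} \<and> j \<in> {1..5} \<and> k \<in> {1..5} \<and> l \<in> {1..5} \<and> m \<in> {1..5}"
proof
  assume "{i, j, k, l, m} = {1..5}"
  then show "distinct [i,j,k,l,m] \<and> i \<in> {1..5} \<and> j \<in> {1..5} \<and> k \<in> {1..5} \<and> l \<in> {1..5} \<and> m \<in> {1..5}"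
    using vertices_distinct by blast
next
  assume a: "distinct [i,j,k,l,m] \<and> i \<in> {1..5} \<and> j \<in> {1..5} \<and> k \<in> {1..5} \<and> l \<in> {1..5} \<and> m \<in> {1..5}"
  then have "card {i,j,k,l,m} = 5" using distinct_card[of "[i,j,k,l,m]"] by simp
  then show "{i, j, k, l, m} = {1..5}" using a by (intro card_subset_eq) auto
qed

lemma cyclic_arrangements_eq: "cyclic_arrangements = {(1,2,3,4,5),(1,2,3,5,4),(1,2,4,3,5),(1,2,4,5,3),(1,2,5,3,4),(1,2,5,4,3),
  (1,3,2,4,5),(1,3,2,5,4),(1,3,4,2,5),(1,3,5,2,4),(1,4,2,3,5),(1,4,3,2,5)}" (is "_ = ?R")
proof (intro equalityI subsetI)
  fix x assume "x \<in> cyclic_arrangements"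
  then obtain j k l m where x: "x = (1,j,k,l,m)" and p: "{1,j,k,l,m} = {1..5}" and jm: "j < m"
    unfolding cyclic_arrangements_def by auto
  from p have d: "distinct [1,j,k,l,m]" and r: "j \<in> {1..5}" "k \<in> {1..5}" "l \<in> {1..5}" "m \<in> {1..5}"
    unfolding vertices_iff by auto
  have "j=2\<or>j=3\<or>j=4" "k=2\<or>k=3\<or>k=4\<or>k=5" "l=2\<or>l=3\<or>l=4\<or>l=5" "m=3\<or>m=4\<or>m=5"
  proof -
    have "1 < j" "1 < k" "1 < l" using r d by (auto simp: less_le)
    then show "j=2\<or>j=3\<or>j=4" "k=2\<or>k=3\<or>k=4\<or>k=5" "l=2\<or>l=3\<or>l=4\<or>l=5" "m=3\<or>m=4\<or>m=5"
      using r jm unfolding atLeastAtMost_iff by arith+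
  qed
  with d jm show "x \<in> ?R" unfolding x
    by (elim disjE) simp_all
qed (auto simp: cyclic_arrangements_def vertices_iff)

lemma pair_splittings_eq: "pair_splittings = {(1,2,3,4,5),(1,3,2,4,5),(1,4,2,3,5),(1,5,2,3,4),(2,3,1,4,5),
  (2,4,1,3,5),(2,5,1,3,4),(3,4,1,2,5),(3,5,1,2,4),(4,5,1,2,3)}" (is "_ = ?R")
proof (intro equalityI subsetI)
  fix x assume "x \<in> pair_splittings"
  then obtain i j k l m where x: "x = (i,j,k,l,m)" and p: "{i,j,k,l,m} = {1..5}" and jm: "i < j" "k < l" "l < m"
    unfolding pair_splittings_def by auto
  from p have d: "distinct [i,j,k,l,m]" and r: "i \<in> {1..5}" "j \<in> {1..5}" "k \<in> {1..5}" "l \<in> {1..5}" "m \<in> {1..5}"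
    unfolding vertices_iff by auto
  have "k=1\<or>k=2\<or>k=3" "l=2\<or>l=3\<or>l=4" "m=3\<or>m=4\<or>m=5" using r jm by auto
  with r(1,2) d jm show "x \<in> ?R" unfolding mem_vertices_iff x 
    by (elim disjE) simp_all
qed (auto simp: pair_splittings_def vertices_iff)

lemma card_pair_splittings: "card pair_splittings = 10" unfolding pair_splittings_eq by simp
lemma card_cyclic_arrangements: "card cyclic_arrangements = 12" unfolding cyclic_arrangements_eq by simp

lemma cycle_edges_rotate: "cycle_edges (i,j,k,l,m) = cycle_edges (j,k,l,m,i)"
  by (auto simp: cycle_edges_def)
lemma cycle_neighbours:
  assumes "distinct [i, j, k, l, m]"
  shows "{b. {i, b} \<in> cycle_edges (i, j, k, l, m)} = {j, m}"
proof -
  have "{i, b} \<in> cycle_edges (i, j, k, l, m) \<longleftrightarrow> b = j \<or> b = m" for b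
    using assms by (simp add: cycle_edges_def doubleton_eq_iff)
  then show ?thesis by auto
qed

lemma cycle_neighbours_next:
  assumes "distinct [i, j, k, l, m]"
  shows "{b. {j, b} \<in> cycle_edges (i, j, k, l, m)} = {k, i}" "{b. {m, b} \<in> cycle_edges (i, j, k, l, m)} = {i, l}"
proof -
  have "distinct [j, k, l, m, i]" "distinct [m, i, j, k, l]" using assms by auto
  from this[THEN cycle_neighbours] show "{b. {j, b} \<in> cycle_edges (i, j, k, l, m)} = {k, i}"
    "{b. {m, b} \<in> cycle_edges (i, j, k, l, m)} = {i, l}"
    by (simp_all only: cycle_edges_rotate[of i j k l m] cycle_edges_rotate[of m i j k l])
qed

lemma inj_on_cycle_edges: "inj_on cycle_edges cyclic_arrangements"
proof (rule inj_onI)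
  fix x y assume "x \<in> cyclic_arrangements" "y \<in> cyclic_arrangements" and e: "cycle_edges x = cycle_edges y"
  then obtain j k l m j' k' l' m' where x: "x = (1,j,k,l,m)" and p: "{1,j,k,l,m} = {1..5}" and jm: "j < m"
    and y: "y = (1,j',k',l',m')" and p': "{1,j',k',l',m'} = {1..5}" and jm': "j' < m'"
    unfolding cyclic_arrangements_def by auto
  define E where "E a = {b. {a,b} \<in> cycle_edges x}" for a
  note d = vertices_distinct[OF p] and d' = vertices_distinct[OF p']
  have "E 1 = {j,m}" "E j = {1,k}" "E m = {1,l}"
    using cycle_neighbours[OF d] cycle_neighbours_next[OF d] unfolding E_def x by (simp_all add: insert_commute)
  note 1 = this
  have 2: "E 1 = {j',m'}" "E j' = {1,k'}" "E m' = {1,l'}"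
    using cycle_neighbours[OF d'] cycle_neighbours_next[OF d'] unfolding E_def e y by (simp_all add: insert_commute)
  have "{j,m} = {j',m'}" using 1(1) 2(1) by simp
  then have j: "j = j'" and m: "m = m'"
    using jm jm' by (auto simp: doubleton_eq_iff)
  have "{1,k} = {1,k'}" "{1,l} = {1,l'}" using 1 2 j m by simp_all
  then have "k = k'" "l = l'" by (auto simp: doubleton_eq_iff)
  note this j m
  then show "x = y" using x y by simp
qed

lemma cycle_edges_reverse: "cycle_edges (i,j,k,l,m) = cycle_edges (i,m,l,k,j)"
  by (auto simp: cycle_edges_def insert_commute)

lemma cycle_edges_start_one: assumes "{1,j,k,l,m} = {1..5}" shows "cycle_edges (1,j,k,l,m) \<in> cycle_edges ` cyclic_arrangements"
proof (cases "j < m")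
  case True then show ?thesis using assms by (intro imageI) (auto simp: cyclic_arrangements_def)
next
  case False 
  with vertices_distinct[OF assms] have "m < j" by (auto simp: not_less le_less)
  then have "(1,m,l,k,j) \<in> cyclic_arrangements" using assms by (auto simp: cyclic_arrangements_def)
  then show ?thesis by (subst cycle_edges_reverse) (rule imageI)
qed

lemma cycle_edges_image: "cycle_edges ` cyclic_arrangements = hamiltonian_cycles"
proof (intro equalityI subsetI)
  fix e assume "e \<in> hamiltonian_cycles"
  then obtain i j k l m where e: "e = cycle_edges (i,j,k,l,m)" and p: "{i,j,k,l,m} = {1..5}"
    unfolding hamiltonian_cycles_def by auto
  have "1 \<in> {i,j,k,l,m}" unfolding p by simp
  then consider "i=1"|"j=1"|"k=1"|"l=1"|"m=1" by blast
  then show "e \<in> cycle_edges ` cyclic_arrangements"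
  proof cases
    case 1 then show ?thesis using e p cycle_edges_start_one by blast
  next case 2 
    have "{j,k,l,m,i} = {1..5}" using p by blast
    with 2 show ?thesis using cycle_edges_start_one[of k l m i] e cycle_edges_rotate by metis
  next case 3
    have "{k,l,m,i,j} = {1..5}" using p by blast
    with 3 show ?thesis using cycle_edges_start_one[of l m i j] e cycle_edges_rotate by metis
  next case 4
    have "{l,m,i,j,k} = {1..5}" using p by blast
    with 4 show ?thesis using cycle_edges_start_one[of m i j k] e cycle_edges_rotate by metis
  next case 5
    have "{m,i,j,k,l} = {1..5}" using p by blast
    with 5 show ?thesis using cycle_edges_start_one[of i j k l] e cycle_edges_rotate by metis
  qed
qed (auto simp: cyclic_arrangements_def hamiltonian_cycles_def)

lemma bij_betw_cycle_edges: "bij_betw cycle_edges cyclic_arrangements hamiltonian_cycles"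
  using inj_on_cycle_edges cycle_edges_image by (simp add: bij_betw_def)

end

(* The squares of the lambda-lengths are the pairwise products of null vectors in Minkowski
   space R^{3,1}: a horosphere corresponds to a point of the light cone. Five vectors of a
   four-dimensional space have vanishing Gram determinant, and this Gram matrix has zero diagonal,
   so only the derangements of five letters contribute to the determinant. The 5-cycles
   give twice the right-hand side, the products of a transposition and a 3-cycle give minus twice
   the left-hand side. *)
theory Submission imports Defs begin

section \<open>Squared lambda-lengths\<close>

lemma dist_Pair_squared: "(dist (x, s) (y, t))\<^sup>2 = (dist x y)\<^sup>2 + (dist s t)\<^sup>2"
  by (simp add: dist_Pair_Pair)

text \<open>Since \<open>cosh (ln u) = (u + inverse u) / 2\<close>, the hypothesis makes the
  argument of \<open>arcosh\<close> equal to \<open>cosh \<bar>ln u\<bar>\<close>.\<close>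

lemma hyp_dist_eq_abs_ln:
  assumes "u > 0" and "(dist p q)\<^sup>2 / (2 * snd p * snd q) = (u + inverse u) / 2 - 1"
  shows "hyp_dist p q = \<bar>ln u\<bar>"
proof -
  have "hyp_dist p q = arcosh (cosh \<bar>ln u\<bar>)"
    using assms by (simp add: hyp_dist_def cosh_ln_real)
  also have "\<dots> = \<bar>ln u\<bar>" by (rule arcosh_cosh_real) simp
  finally show ?thesis .
qed

text \<open>Overlap of the horoballs corresponds to \<open>u < 1\<close>, so the sign in
  \<open>signed_dist\<close> turns \<open>\<bar>ln u\<bar>\<close> into \<open>ln u\<close>. Each
  pair of centres then needs only its two feet, a disjointness criterion and one distance.\<close>

lemma lambda_length_squared:
  assumes "u > 0"
    and "geodesic A B \<inter> horosphere A r = {p}" and "geodesic A B \<inter> horosphere B s = {q}"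
    and "r > 0" and "s > 0"
    and "horoball A r \<inter> horoball B s = {} \<longleftrightarrow> u \<ge> 1"
    and "(dist p q)\<^sup>2 / (2 * snd p * snd q) = (u + inverse u) / 2 - 1"
  shows "(lambda_length A (horosphere A r) B (horosphere B s))\<^sup>2 = u"
proof -
  have "(THE x. x \<in> geodesic A B \<inter> horosphere A r) = p"
    "(THE x. x \<in> geodesic A B \<inter> horosphere B s) = q"
    using assms(2,3) by simp_all
  then have "signed_dist A (horosphere A r) B (horosphere B s) = ln u"
    using assms(1,4-6) hyp_dist_eq_abs_ln[OF assms(1,7)]
    unfolding signed_dist_def by (auto simp: horoball_bounded_by_horosphere)
  then show ?thesis
    using assms(1) unfolding lambda_length_def
    by (simp add: power2_eq_square flip: exp_add)
qed

lemma geodesic_commute: "geodesic A B = geodesic B A"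
  by (cases A; cases B) (simp_all add: midpoint_sym dist_commute insert_commute)

lemma lambda_length_commute: "lambda_length A h B k = lambda_length B k A h"
proof -
  have "hyp_dist p q = hyp_dist q p" for p q
    by (simp add: hyp_dist_def dist_commute mult_ac)
  then show ?thesis
    unfolding lambda_length_def signed_dist_def
    by (simp add: geodesic_commute[of A B] Int_commute Let_def)
qed

section \<open>One horosphere at infinity, one at a finite point\<close>

lemma lambda_length_Infty_Fin:
  assumes "r > 0" and "s > 0"
  shows "(lambda_length Infty (horosphere Infty r) (Fin b) (horosphere (Fin b) s))\<^sup>2 = r / (2 * s)"
proof (rule lambda_length_squared)
  show "geodesic Infty (Fin b) \<inter> horosphere Infty r = {(b, r)}"
    using assms by (auto simp: hyp3_def)
  show "geodesic Infty (Fin b) \<inter> horosphere (Fin b) s = {(b, 2 * s)}"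
    using assms by (auto simp: hyp3_def dist_Pair_Pair dist_real_def)
  show "horoball Infty r \<inter> horoball (Fin b) s = {} \<longleftrightarrow> r / (2 * s) \<ge> 1"
  proof
    assume disj: "horoball Infty r \<inter> horoball (Fin b) s = {}"
    show "r / (2 * s) \<ge> 1"
    proof (rule ccontr)
      assume "\<not> r / (2 * s) \<ge> 1"
      then have "r < 2 * s" using assms by (simp add: field_simps)
      \<comment> \<open>The height halfway between the plane at \<open>r\<close> and the top
        \<open>2 * s\<close> of the ball.\<close>
      then have "(b, (r + 2 * s) / 2) \<in> horoball Infty r \<inter> horoball (Fin b) s"
        using assms by (simp add: dist_Pair_Pair) (simp add: dist_real_def abs_if field_simps)
      then show False using disj by blast
    qed
  next
    assume "r / (2 * s) \<ge> 1"
    then have "2 * s \<le> r" using assms by (simp add: field_simps)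
    moreover have "t < 2 * s" if "(z, t) \<in> ball (b, s) s" for z t
      using that dist_snd_le[of "(b, s)" "(z, t)"] by (simp add: dist_real_def)
    ultimately show "horoball Infty r \<inter> horoball (Fin b) s = {}" by fastforce
  qed
  show "(dist (b, r) (b, 2 * s))\<^sup>2 / (2 * snd (b, r) * snd (b, 2 * s)) =
      (r / (2 * s) + inverse (r / (2 * s))) / 2 - 1"
    unfolding dist_Pair_squared
    using assms by (simp add: dist_real_def field_simps power2_eq_square)
qed (use assms in auto)

section \<open>Two horospheres at finite points\<close>

text \<open>Subtracting the equations of the geodesic and of the horosphere, as circles in the vertical
  plane through \<open>a\<close> and \<open>b\<close>, gives \<open>t d = 2 r z\<close> for the point \<open>(a + t (b - a), z)\<close>.\<close>

definition foot :: "complex \<Rightarrow> complex \<Rightarrow> real \<Rightarrow> complex \<times> real" where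
  "foot a b r = (let d = (dist a b)\<^sup>2 in
     (a + (4 * r\<^sup>2 / (d + 4 * r\<^sup>2)) *\<^sub>R (b - a), 2 * r * d / (d + 4 * r\<^sup>2)))"

lemma dist_eq_iff_power2: "e \<ge> 0 \<Longrightarrow> dist x y = e \<longleftrightarrow> (dist x y)\<^sup>2 = e\<^sup>2"
  by (metis zero_le_dist power2_eq_iff_nonneg)

lemma dist_along_squared:
  fixes a b :: complex
  shows "(dist (a + x *\<^sub>R (b - a)) (a + y *\<^sub>R (b - a)))\<^sup>2 = (x - y)\<^sup>2 * (dist a b)\<^sup>2"
  by (simp add: dist_norm norm_minus_commute[of a b] power_mult_distrib flip: scaleR_left_diff_distrib)

text \<open>Thales: the squared altitude over the diameter from \<open>a\<close> to \<open>b\<close>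
  is the product of the two segments that it cuts off.\<close>

lemma geodesic_Fin_param:
  "(a + t *\<^sub>R (b - a), z) \<in> geodesic (Fin a) (Fin b) \<longleftrightarrow>
     z > 0 \<and> z\<^sup>2 = t * (1 - t) * (dist a b)\<^sup>2"
proof -
  have "midpoint a b = a + (1/2) *\<^sub>R (b - a)"
    by (simp add: midpoint_def scaleR_conv_of_real field_simps)
  then have "(dist (midpoint a b, 0) (a + t *\<^sub>R (b - a), z))\<^sup>2 = (1/2 - t)\<^sup>2 * (dist a b)\<^sup>2 + z\<^sup>2"
    by (simp only: dist_Pair_squared dist_along_squared) (simp add: dist_real_def)
  then have "dist (midpoint a b, 0) (a + t *\<^sub>R (b - a), z) = dist a b / 2 \<longleftrightarrow>
      (1/2 - t)\<^sup>2 * (dist a b)\<^sup>2 + z\<^sup>2 = (dist a b / 2)\<^sup>2"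
    by (subst dist_eq_iff_power2) simp_all
  also have "\<dots> \<longleftrightarrow> z\<^sup>2 = t * (1 - t) * (dist a b)\<^sup>2"
    by (auto simp: power2_eq_square field_simps)
  finally have "dist (midpoint a b, 0) (a + t *\<^sub>R (b - a), z) = dist a b / 2 \<longleftrightarrow>
      z\<^sup>2 = t * (1 - t) * (dist a b)\<^sup>2" .
  moreover have "a + t *\<^sub>R (b - a) \<in> affine hull {a, b}"
    by (auto simp: affine_hull_2_alt)
  ultimately show ?thesis
    by (auto simp: hyp3_def)
qed

lemma horosphere_Fin_param:
  assumes "r > 0"
  shows "(a + t *\<^sub>R (b - a), z) \<in> horosphere (Fin a) r \<longleftrightarrow>
     z > 0 \<and> t\<^sup>2 * (dist a b)\<^sup>2 + z\<^sup>2 = 2 * r * z"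
proof -
  have "(dist (a, r) (a + t *\<^sub>R (b - a), z))\<^sup>2 = t\<^sup>2 * (dist a b)\<^sup>2 + (r - z)\<^sup>2"
    using dist_along_squared[of a 0 b t] by (simp add: dist_Pair_squared) (simp add: dist_real_def)
  then have "dist (a, r) (a + t *\<^sub>R (b - a), z) = r \<longleftrightarrow> t\<^sup>2 * (dist a b)\<^sup>2 + (r - z)\<^sup>2 = r\<^sup>2"
    using assms by (subst dist_eq_iff_power2) simp_all
  also have "\<dots> \<longleftrightarrow> t\<^sup>2 * (dist a b)\<^sup>2 + z\<^sup>2 = 2 * r * z"
    by (auto simp: power2_eq_square algebra_simps)
  finally show ?thesis
    by (auto simp: hyp3_def)
qed

lemma geodesic_inter_horosphere:
  assumes "a \<noteq> b" and "r > 0"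
  shows "geodesic (Fin a) (Fin b) \<inter> horosphere (Fin a) r = {foot a b r}"
proof (intro equalityI subsetI)
  define d where "d = (dist a b)\<^sup>2"
  have d: "d > 0" using assms by (simp add: d_def)
  have "d + 4 * r\<^sup>2 > 0" using d by (simp add: add_pos_nonneg)
  then have n: "d + 4 * r\<^sup>2 \<noteq> 0" by simp
  {
    fix p assume p: "p \<in> geodesic (Fin a) (Fin b) \<inter> horosphere (Fin a) r"
    then have "fst p \<in> affine hull {a, b}" by simp
    then obtain t where "fst p = a + t *\<^sub>R (b - a)" by (auto simp: affine_hull_2_alt)
    then obtain z where pz: "p = (a + t *\<^sub>R (b - a), z)" by (metis prod.collapse)
    from p have z: "z > 0" and g: "z\<^sup>2 = t * (1 - t) * d" and h: "t\<^sup>2 * d + z\<^sup>2 = 2 * r * z"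
      unfolding pz Int_iff geodesic_Fin_param horosphere_Fin_param[OF assms(2)] d_def by auto
    have td: "t * d = 2 * r * z" using g h by (simp add: power2_eq_square algebra_simps)
    have "z * (z * d) = z * (2 * r * (d - t * d))"
      using g td by (simp add: power2_eq_square) algebra
    \<comment> \<open>Cancelling \<open>z > 0\<close> discards the other common point of the two
      circles, the ideal point \<open>a\<close>.\<close>
    then have "z * d = 2 * r * (d - 2 * r * z)" using z td by simp
    then have "z * (d + 4 * r\<^sup>2) = 2 * r * d" by (simp add: power2_eq_square algebra_simps)
    then have z': "z = 2 * r * d / (d + 4 * r\<^sup>2)" using n by (simp add: field_simps)
    have "t = 2 * r * z / d" using td d by (simp add: field_simps)
    then have "t = 4 * r\<^sup>2 / (d + 4 * r\<^sup>2)"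
      using d n unfolding z' by (simp add: power2_eq_square)
    then show "p \<in> {foot a b r}" using z' by (simp add: pz foot_def d_def Let_def)
  next
    fix p assume "p \<in> {foot a b r}"
    then have p: "p = (a + (4 * r\<^sup>2 / (d + 4 * r\<^sup>2)) *\<^sub>R (b - a), 2 * r * d / (d + 4 * r\<^sup>2))"
      by (simp add: foot_def d_def Let_def)
    have "2 * r * d / (d + 4 * r\<^sup>2) > 0" using assms(2) d by (simp add: add_pos_nonneg)
    moreover have "1 - 4 * r\<^sup>2 / (d + 4 * r\<^sup>2) = d / (d + 4 * r\<^sup>2)"
      using n by (simp add: diff_divide_eq_iff)
    then have "(2 * r * d / (d + 4 * r\<^sup>2))\<^sup>2 = 4 * r\<^sup>2 / (d + 4 * r\<^sup>2) * (1 - 4 * r\<^sup>2 / (d + 4 * r\<^sup>2)) * d"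
      by (simp add: power2_eq_square)
    moreover have "(4 * r\<^sup>2 / (d + 4 * r\<^sup>2))\<^sup>2 * d + (2 * r * d / (d + 4 * r\<^sup>2))\<^sup>2 =
        4 * r\<^sup>2 * d * (d + 4 * r\<^sup>2) / (d + 4 * r\<^sup>2)\<^sup>2"
      by (simp add: power_divide add_divide_distrib[symmetric])
        (simp add: power2_eq_square power4_eq_xxxx algebra_simps)
    then have "(4 * r\<^sup>2 / (d + 4 * r\<^sup>2))\<^sup>2 * d + (2 * r * d / (d + 4 * r\<^sup>2))\<^sup>2 = 2 * r * (2 * r * d / (d + 4 * r\<^sup>2))"
      using n by (simp add: power2_eq_square)
    ultimately show "p \<in> geodesic (Fin a) (Fin b) \<inter> horosphere (Fin a) r"
      unfolding p Int_iff geodesic_Fin_param horosphere_Fin_param[OF assms(2)] d_def by blast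
  }
qed


text \<open>With \<open>d = 4 * r * s * u\<close>, the quotient simplifies to
  \<open>(u - 1)^2 / (2 * u)\<close>.\<close>

lemma foot_cosh:
  assumes "a \<noteq> b" and "r > 0" and "s > 0"
  defines "u \<equiv> (dist a b)\<^sup>2 / (4 * r * s)"
  shows "(dist (foot a b r) (foot b a s))\<^sup>2 / (2 * snd (foot a b r) * snd (foot b a s)) =
    (u + inverse u) / 2 - 1"
proof -
  define d where "d = (dist a b)\<^sup>2"
  have d: "d > 0" "(dist b a)\<^sup>2 = d" using assms by (simp_all add: d_def dist_commute)
  define m n where "m = d + 4 * r\<^sup>2" and "n = d + 4 * s\<^sup>2"
  have mn: "m > 0" "n > 0" using d by (simp_all add: m_def n_def add_pos_nonneg)
  \<comment> \<open>The second foot is rewritten with base point \<open>a\<close>, so that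
    \<open>dist_along_squared\<close> applies to both feet.\<close>
  have b: "b + (4 * s\<^sup>2 / n) *\<^sub>R (a - b) = a + (d / n) *\<^sub>R (b - a)"
  proof -
    have "d / n = 1 - 4 * s\<^sup>2 / n" using mn by (simp add: eq_divide_eq diff_divide_eq_iff) (simp add: n_def)
    then show ?thesis by (simp add: scaleR_left_diff_distrib scaleR_right_diff_distrib)
  qed
  have fa: "foot a b r = (a + (4 * r\<^sup>2 / m) *\<^sub>R (b - a), 2 * r * d / m)"
    by (simp add: foot_def d_def m_def Let_def)
  have fb: "foot b a s = (a + (d / n) *\<^sub>R (b - a), 2 * s * d / n)"
    using b by (simp add: foot_def d n_def Let_def)
  have "(dist (foot a b r) (foot b a s))\<^sup>2 =
      (4 * r\<^sup>2 / m - d / n)\<^sup>2 * d + (2 * r * d / m - 2 * s * d / n)\<^sup>2"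
    unfolding fa fb dist_Pair_squared dist_along_squared d_def by (simp add: dist_real_def)
  also have "\<dots> = ((4 * r\<^sup>2 * n - d * m)\<^sup>2 * d + (2 * r * d * n - 2 * s * d * m)\<^sup>2) / (m * n)\<^sup>2"
  proof -
    have "4 * r\<^sup>2 / m - d / n = (4 * r\<^sup>2 * n - d * m) / (m * n)"
      "2 * r * d / m - 2 * s * d / n = (2 * r * d * n - 2 * s * d * m) / (m * n)"
      using mn by (simp_all add: diff_frac_eq)
    then show ?thesis by (simp add: power_divide add_divide_distrib)
  qed
  \<comment> \<open>The two terms squared are \<open>-(d - 4*r*s) * (d + 4*r*s)\<close> and
    \<open>2*d*(r - s) * (d - 4*r*s)\<close>; moreover
    \<open>m * n = (d + 4*r*s)^2 + 4*d*(r - s)^2\<close>.\<close>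
  also have "(4 * r\<^sup>2 * n - d * m)\<^sup>2 * d + (2 * r * d * n - 2 * s * d * m)\<^sup>2 = (d - 4 * r * s)\<^sup>2 * d * (m * n)"
    unfolding m_def n_def by algebra
  also have "\<dots> / (m * n)\<^sup>2 = (d - 4 * r * s)\<^sup>2 * d / (m * n)"
    using mn by (simp add: power2_eq_square)
  finally have "(dist (foot a b r) (foot b a s))\<^sup>2 / (2 * snd (foot a b r) * snd (foot b a s)) =
      (d - 4 * r * s)\<^sup>2 / (8 * r * s * d)"
    using mn d(1) assms(2,3) unfolding fa fb by (simp add: power2_eq_square)
  also have "\<dots> = (u + inverse u) / 2 - 1"
    using d(1) assms(2,3) unfolding u_def d_def[symmetric] by (simp add: field_simps power2_eq_square)
  finally show ?thesis .
qed

lemma balls_disjoint_iff: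
  fixes x y :: "'a::real_normed_vector"
  assumes "r > 0" and "s > 0"
  shows "ball x r \<inter> ball y s = {} \<longleftrightarrow> r + s \<le> dist x y"
proof
  assume disj: "ball x r \<inter> ball y s = {}"
  show "r + s \<le> dist x y"
  proof (rule ccontr)
    assume lt: "\<not> r + s \<le> dist x y"
    \<comment> \<open>This point divides the segment from \<open>x\<close> to \<open>y\<close> in
      the ratio \<open>r : s\<close>.\<close>
    define z where "z = x + (r / (r + s)) *\<^sub>R (y - x)"
    have "x - z = - (r / (r + s)) *\<^sub>R (y - x)" by (simp add: z_def)
    then have zx: "dist x z = r / (r + s) * dist x y"
      using assms by (simp add: dist_norm norm_minus_commute)
    have "1 - r / (r + s) = s / (r + s)" using assms by (simp add: field_simps)
    moreover have "y - z = (1 - r / (r + s)) *\<^sub>R (y - x)" by (simp add: z_def algebra_simps)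
    ultimately have zy: "dist y z = s / (r + s) * dist x y"
      using assms by (simp add: dist_norm norm_minus_commute)
    have "z \<in> ball x r \<inter> ball y s"
      using lt assms mult_strict_left_mono[of "dist x y" "r + s"]
      by (simp add: zx zy pos_divide_less_eq)
    then show False using disj by blast
  qed
next
  assume "r + s \<le> dist x y"
  then show "ball x r \<inter> ball y s = {}" by (rule disjoint_ballI)
qed

lemma lambda_length_Fin_Fin:
  assumes "a \<noteq> b" and "r > 0" and "s > 0"
  shows "(lambda_length (Fin a) (horosphere (Fin a) r) (Fin b) (horosphere (Fin b) s))\<^sup>2 =
    (dist a b)\<^sup>2 / (4 * r * s)"
proof (rule lambda_length_squared)
  show "geodesic (Fin a) (Fin b) \<inter> horosphere (Fin a) r = {foot a b r}"
    using assms by (intro geodesic_inter_horosphere)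
  show "geodesic (Fin a) (Fin b) \<inter> horosphere (Fin b) s = {foot b a s}"
    using assms by (subst geodesic_commute) (intro geodesic_inter_horosphere, auto)
  \<comment> \<open>The centres lie at heights \<open>r\<close> and \<open>s\<close>, and
    \<open>(r + s)^2 - (r - s)^2 = 4 * r * s\<close>.\<close>
  have "r + s \<le> dist (a, r) (b, s) \<longleftrightarrow> (r + s)\<^sup>2 \<le> (dist (a, r) (b, s))\<^sup>2"
    using assms abs_le_square_iff[of "r + s" "dist (a, r) (b, s)"] by simp
  also have "\<dots> \<longleftrightarrow> 4 * r * s \<le> (dist a b)\<^sup>2"
    by (simp only: dist_Pair_squared) (simp add: dist_real_def power2_eq_square algebra_simps)
  finally show "horoball (Fin a) r \<inter> horoball (Fin b) s = {} \<longleftrightarrow> (dist a b)\<^sup>2 / (4 * r * s) \<ge> 1"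
    using assms by (simp add: balls_disjoint_iff le_divide_eq_1_pos)
qed (use assms foot_cosh in auto)

section \<open>The Gram determinant\<close>

lemma exhaust_5: fixes x :: 5 shows "x = 1 \<or> x = 2 \<or> x = 3 \<or> x = 4 \<or> x = 5"
proof (induct x)
  case (of_int z)
  then have "0 \<le> z" and "z < 5" by simp_all
  \<comment> \<open>In the type \<open>5\<close> the numeral 5 equals 0, so the case
    \<open>z = 0\<close> gives the last alternative.\<close>
  then have "z = 0 \<or> z = 1 \<or> z = 2 \<or> z = 3 \<or> z = 4" by arith
  then show ?case by auto
qed

lemma UNIV_5: "UNIV = {1, 2, 3, 4, 5::5}"
  using exhaust_5 by auto

text \<open>Of the 44 derangements, 24 are 5-cycles (even) and 20 are a transposition times a
  3-cycle (odd). By symmetry, inverting a 5-cycle or the 3-cycle leaves the product unchanged, hence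
  the factors 2 with 12 and 10 terms.\<close>

lemma det_5_hollow_symmetric:
  fixes A :: "'a::comm_ring_1^5^5"
  assumes hollow: "\<And>i. A$i$i = 0" and sym: "\<And>i j. A$i$j = A$j$i"
  defines "g i j k l m \<equiv> (A$i$j)\<^sup>2 * A$k$l * A$l$m * A$m$k"
    and "c i j k l m \<equiv> A$i$j * A$j$k * A$k$l * A$l$m * A$m$i"
  shows "det A =
    2 * (c 1 2 3 4 5 + c 1 2 3 5 4 + c 1 2 4 3 5 + c 1 2 4 5 3 + c 1 2 5 3 4 + c 1 2 5 4 3 +
         c 1 3 2 4 5 + c 1 3 2 5 4 + c 1 3 4 2 5 + c 1 3 5 2 4 + c 1 4 2 3 5 + c 1 4 3 2 5) -
    2 * (g 1 2 3 4 5 + g 1 3 2 4 5 + g 1 4 2 3 5 + g 1 5 2 3 4 + g 2 3 1 4 5 +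
         g 2 4 1 3 5 + g 2 5 1 3 4 + g 3 4 1 2 5 + g 3 5 1 2 4 + g 4 5 1 2 3)"
proof -
  have f1234: "finite {2::5,3,4,5}" "1 \<notin> {2::5,3,4,5}" by auto
  have f234: "finite {3::5,4,5}" "2 \<notin> {3::5,4,5}" by auto
  have f34: "finite {4::5,5}" "3 \<notin> {4::5,5}" by auto
  have f4: "finite {5::5}" "4 \<notin> {5::5}" by auto
  have s: "A$2$1 = A$1$2" "A$3$1 = A$1$3" "A$4$1 = A$1$4" "A$5$1 = A$1$5" "A$3$2 = A$2$3"
    "A$4$2 = A$2$4" "A$5$2 = A$2$5" "A$4$3 = A$3$4" "A$5$3 = A$3$5" "A$5$4 = A$4$5"
    by (rule sym)+
  show ?thesis
    unfolding det_def UNIV_5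
    unfolding sum_over_permutations_insert[OF f1234]
    unfolding sum_over_permutations_insert[OF f234]
    unfolding sum_over_permutations_insert[OF f34]
    unfolding sum_over_permutations_insert[OF f4]
    unfolding permutes_sing g_def c_def
    by (simp add: sign_swap_id permutation_swap_id sign_compose permutation_compose hollow)
      (simp add: s power2_eq_square algebra_simps)
qed

text \<open>The matrix is a product whose left factor has a zero column; padding vectors with a zero
  coordinate thus handles Gram matrices of too many vectors.\<close>

lemma det_matrix_mult_rank_deficient:
  fixes f g :: "'n::finite \<Rightarrow> 'n \<Rightarrow> 'a::field"
  assumes "\<And>i. f i k = 0"
  shows "det (\<chi> i j. \<Sum>l\<in>UNIV. f i l * g j l) = 0"
proof -
  have "(\<chi> i j. \<Sum>l\<in>UNIV. f i l * g j l) = (\<chi> i l. f i l) ** (\<chi> l j. g j l)"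
    by (simp add: matrix_matrix_mult_def)
  moreover have "column k (\<chi> i l. f i l) = 0"
    using assms by (simp add: column_def vec_eq_iff)
  ultimately show ?thesis by (simp only: det_mul det_zero_column(2) mult_zero_left)
qed

section \<open>Horospheres as null vectors\<close>

text \<open>In the coordinates \<open>(x, y, p, w)\<close> the quadratic form is \<open>2 (p w - x\<^sup>2 - y\<^sup>2)\<close>; a
  horosphere at \<open>z = x/w + i y/w\<close> of Euclidean radius \<open>r\<close> has \<open>w = 1/(2r)\<close>, and \<open>\<infinity>\<close> is
  the ray \<open>w = 0\<close>.\<close>

fun null_vector :: "riemann_sphere \<Rightarrow> real \<Rightarrow> real \<times> real \<times> real \<times> real" where
  "null_vector (Fin a) r = (Re a / (2 * r), Im a / (2 * r), (cmod a)\<^sup>2 / (2 * r), 1 / (2 * r))"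
| "null_vector Infty r = (0, 0, r, 0)"

fun lorentz_form :: "real \<times> real \<times> real \<times> real \<Rightarrow> real \<times> real \<times> real \<times> real \<Rightarrow> real" where
  "lorentz_form (x, y, p, w) (x', y', p', w') = p * w' + w * p' - 2 * (x * x' + y * y')"

lemma lorentz_form_commute: "lorentz_form u v = lorentz_form v u"
  by (cases u; cases v) (simp add: algebra_simps)

text \<open>The vectors satisfy \<open>p * w = x^2 + y^2\<close>, which gives the Gram matrix its
  zero diagonal.\<close>

lemma lorentz_form_null_vector_self: "lorentz_form (null_vector A r) (null_vector A r) = 0"
  by (cases A, simp_all add: cmod_power2) (simp add: power2_eq_square add_divide_distrib)

text \<open>For finite centres the form expands to the polarised \<open>(dist a b)^2\<close>,
  divided by \<open>4 * r * s\<close>.\<close>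

lemma lambda_length_squared_eq_lorentz_form:
  assumes "A \<noteq> B" and "r > 0" and "s > 0"
  shows "(lambda_length A (horosphere A r) B (horosphere B s))\<^sup>2 =
    lorentz_form (null_vector A r) (null_vector B s)"
proof (cases A; cases B)
  fix a b assume "A = Fin a" "B = Fin b"
  moreover have "(dist a b)\<^sup>2 = (cmod a)\<^sup>2 + (cmod b)\<^sup>2 - 2 * (Re a * Re b + Im a * Im b)"
    unfolding dist_norm cmod_power2 by (simp add: power2_eq_square algebra_simps)
  ultimately show ?thesis
    using assms
    by (simp add: lambda_length_Fin_Fin del: horosphere.simps) (simp add: field_simps)
next
  fix b assume "A = Infty" "B = Fin b"
  then show ?thesis using assms
    by (simp add: lambda_length_Infty_Fin del: horosphere.simps)
next
  fix a assume "A = Fin a" "B = Infty"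
  then show ?thesis
    using assms
    by (simp add: lambda_length_commute[of "Fin a"] lambda_length_Infty_Fin del: horosphere.simps)
qed (use assms in auto)

lemma det_lorentz_gram:
  fixes v :: "5 \<Rightarrow> real \<times> real \<times> real \<times> real"
  shows "det (\<chi> i j. lorentz_form (v i) (v j)) = 0"
proof -
  \<comment> \<open>The fifth coordinate is padding by 0; \<open>g\<close> below lists the dual
    coordinates, so that the form becomes a plain dot product.\<close>
  define f where "f i l = (case v i of (x, y, p, w) \<Rightarrow>
    if l = 1 then x else if l = 2 then y else if l = 3 then p else if l = 4 then w else 0)"
    for i l :: 5
  define g where "g j l = (case v j of (x, y, p, w) \<Rightarrow>
    if l = 1 then - 2 * x else if l = 2 then - 2 * y else if l = 3 then w else if l = 4 then p else 0)"
    for j l :: 5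
  have "lorentz_form (v i) (v j) = (\<Sum>l\<in>UNIV. f i l * g j l)" for i j
    unfolding UNIV_5 by (cases "v i"; cases "v j") (simp add: f_def g_def)
  moreover have "f i 5 = 0" for i
    by (simp add: f_def split: prod.split)
  ultimately show ?thesis
    using det_matrix_mult_rank_deficient[of f 5 g] by simp
qed

theorem theorem4p17:
  fixes X :: "nat \<Rightarrow> riemann_sphere"
    and h :: "nat \<Rightarrow> (complex \<times> real) set"
    and lam :: "nat \<Rightarrow> nat \<Rightarrow> real"
  assumes "inj_on X {1..5}"
    and "\<And>i. i \<in> {1..5} \<Longrightarrow> h i \<in> horospheres_at (X i)"
    and "\<And>i j. lam i j = lambda_length (X i) (h i) (X j) (h j)"
  shows "(\<Sum>(i, j, k, l, m) \<in> pair_splittings.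
            lam i j ^ 4 * (lam k l)\<^sup>2 * (lam l m)\<^sup>2 * (lam m k)\<^sup>2)
       = (\<Sum>(i, j, k, l, m) \<in> cyclic_arrangements.
            (lam i j)\<^sup>2 * (lam j k)\<^sup>2 * (lam k l)\<^sup>2 * (lam l m)\<^sup>2 * (lam m i)\<^sup>2)"
proof -
  have "\<exists>r>0. h i = horosphere (X i) r" if "i \<in> {1..5}" for i
    using assms(2)[OF that] by (auto simp: horospheres_at_def)
  then obtain r where r: "\<And>i. i \<in> {1..5} \<Longrightarrow> r i > 0 \<and> h i = horosphere (X i) (r i)"
    by metis
  \<comment> \<open>\<open>Q\<close> agrees with the squares of \<open>lam\<close> only off the
    diagonal: \<open>Q i i\<close> is 0, whereas \<open>lam i i\<close> is an exponential.\<close>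
  define Q where "Q i j = lorentz_form (null_vector (X i) (r i)) (null_vector (X j) (r j))" for i j
  have lam2: "(lam i j)\<^sup>2 = Q i j" if "i \<in> {1..5}" "j \<in> {1..5}" "i \<noteq> j" for i j
  proof -
    have "X i \<noteq> X j" using that inj_onD[OF assms(1)] by blast
    then show ?thesis
      using r that unfolding Q_def assms(3) by (simp add: lambda_length_squared_eq_lorentz_form)
  qed
  have lam4: "lam i j ^ 4 = (Q i j)\<^sup>2" if "i \<in> {1..5}" "j \<in> {1..5}" "i \<noteq> j" for i j
    using lam2[OF that] power_mult[of "lam i j" 2 2] by simp
  \<comment> \<open>Translates the cyclic type \<open>5\<close>, needed for \<open>det\<close>, into
    the natural-number labels; its element \<open>5 = 0\<close> becomes 5.\<close>
  define \<nu> :: "5 \<Rightarrow> nat" where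
    "\<nu> i = (if i = 1 then 1 else if i = 2 then 2 else if i = 3 then 3 else if i = 4 then 4 else 5)" for i
  define A :: "real^5^5" where "A = (\<chi> i j. Q (\<nu> i) (\<nu> j))"
  have A: "A $ i $ j = Q (\<nu> i) (\<nu> j)" for i j by (simp add: A_def)
  have \<nu>: "\<nu> 1 = 1" "\<nu> 2 = 2" "\<nu> 3 = 3" "\<nu> 4 = 4" "\<nu> 5 = 5" by (simp_all add: \<nu>_def)
  have "det A = 0"
    unfolding A_def Q_def by (rule det_lorentz_gram)
  moreover have "A $ i $ i = 0" for i
    by (simp add: A Q_def lorentz_form_null_vector_self)
  moreover have "A $ i $ j = A $ j $ i" for i j
    unfolding A Q_def by (rule lorentz_form_commute)
  ultimately have Q: "0 =
    2 * (\<Sum>(i, j, k, l, m) \<in> cyclic_arrangements. Q i j * Q j k * Q k l * Q l m * Q m i) -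
    2 * (\<Sum>(i, j, k, l, m) \<in> pair_splittings. (Q i j)\<^sup>2 * Q k l * Q l m * Q m k)"
    using det_5_hollow_symmetric[of A] unfolding A \<nu> pair_splittings_eq cyclic_arrangements_eq
    by simp
  have "(\<Sum>(i, j, k, l, m) \<in> pair_splittings. lam i j ^ 4 * (lam k l)\<^sup>2 * (lam l m)\<^sup>2 * (lam m k)\<^sup>2) =
      (\<Sum>(i, j, k, l, m) \<in> pair_splittings. (Q i j)\<^sup>2 * Q k l * Q l m * Q m k)"
    unfolding pair_splittings_eq by (simp add: lam2 lam4)
  also have "\<dots> = (\<Sum>(i, j, k, l, m) \<in> cyclic_arrangements. Q i j * Q j k * Q k l * Q l m * Q m i)"
    using Q by simp
  also have "\<dots> = (\<Sum>(i, j, k, l, m) \<in> cyclic_arrangements.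
      (lam i j)\<^sup>2 * (lam j k)\<^sup>2 * (lam k l)\<^sup>2 * (lam l m)\<^sup>2 * (lam m i)\<^sup>2)"
    unfolding cyclic_arrangements_eq by (simp add: lam2)
  finally show ?thesis .
qed

end
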